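(* Let $\mathbf{T}=(\mathbf{P}\times\mathbf{P})\cup(\mathbf{Q}\times\mathbf{Q})$, with the topology of a subspace of $\mathbf{C}\times\mathbf{C}$. Then $\mathbf{T}$ is not a right topological group; that is, there is no group operation on the set $\mathbf{T}$ which makes the space $\mathbf{T}$ a right topological group.
   Context: $\mathbf{C}=\{0,1\}^\omega$ is the Cantor set with the product topology. For $x\in\mathbf{C}$ let $\operatorname{supp}x=\{n\in\omega: x(n)=1\}$; $\mathbf{Q}=\{x\in\mathbf{C}: \operatorname{supp}x\text{ is finite}\}$ (homeomorphic to the rationals) and $\mathbf{P}=\mathbf{C}\setminus\mathbf{Q}$ (homeomorphic to the irrationals). A right topological group is a group with a topology such that every right translation $x\mapsto xg$ is continuous. *)

theory Defs
  imports "HOL-Analysis.Analysis" "HOL-Algebra.Group"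
begin

text \<open>
  The Cantor set \<open>{0,1}\<^sup>\<omega>\<close> is the type \<open>nat \<Rightarrow> bool\<close>, with \<open>True\<close> playing the role of \<open>1\<close>.
  Its type class topology is the product topology over the discrete two-point space, as
  \<open>euclidean_cantor\<close> confirms.
\<close>

type_synonym cantor = "nat \<Rightarrow> bool"

lemma euclidean_cantor:
  "(euclidean :: cantor topology) = product_topology (\<lambda>_. discrete_topology UNIV) UNIV"
proof -
  have "(euclidean :: bool topology) = discrete_topology UNIV"
    by (auto simp: topology_eq open_discrete)
  then show ?thesis
    by (metis euclidean_product_topology)
qed

definition supp :: "cantor \<Rightarrow> nat set" where
  "supp x = {n. x n}"

definition cantor_Q :: "cantor set" where
  "cantor_Q = {x. finite (supp x)}"

definition cantor_P :: "cantor set" where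
  "cantor_P = UNIV - cantor_Q"

definition T_set :: "(cantor \<times> cantor) set" where
  "T_set = (cantor_P \<times> cantor_P) \<union> (cantor_Q \<times> cantor_Q)"

definition right_topological_group :: "('a, 'b) monoid_scheme \<Rightarrow> 'a topology \<Rightarrow> bool" where
  "right_topological_group G X \<longleftrightarrow>
     group G \<and> topspace X = carrier G \<and>
     (\<forall>g \<in> carrier G. continuous_map X X (\<lambda>x. x \<otimes>\<^bsub>G\<^esub> g))"

end

theory Submission
  imports Defs
begin

text \<open>
  Let \<open>0\<close> be the zero sequence. The sets \<open>{0} \<times> Q \<subseteq> Q \<times> Q\<close> are countable and the group is
  uncountable, so some right translation moves \<open>{0} \<times> Q\<close> off \<open>Q \<times> Q\<close>, that is, into
  \<open>P \<times> P\<close>. Right translations are homeomorphisms and \<open>{0} \<times> Q\<close> is closed in \<open>T\<close>, so its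
  translate is a closed subset of the Polish space \<open>P \<times> P\<close>. By Baire's theorem this
  countable translate has an isolated point, whereas \<open>{0} \<times> Q\<close> has none.
\<close>

text \<open>Without isolated points the space would be a countable union of closed singletons with
  empty interior, so by Baire's theorem the whole space would have empty interior.\<close>

lemma countable_completely_metrizable_isolated_point:
  assumes X: "completely_metrizable_space X" and "countable (topspace X)" "topspace X \<noteq> {}"
  obtains x where "x \<in> topspace X" "openin X {x}"
proof (rule ccontr)
  assume "\<not> thesis"
  then have no: "\<And>x. x \<in> topspace X \<Longrightarrow> \<not> openin X {x}"
    using that by blast
  have t1: "t1_space X"
    using X by (simp add: completely_metrizable_imp_metrizable_space
        metrizable_imp_Hausdorff_space Hausdorff_imp_t1_space)
  have "X interior_of \<Union>((\<lambda>x. {x}) ` topspace X) = {}"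
  proof (rule Baire_category_alt)
    show "countable ((\<lambda>x. {x}) ` topspace X)"
      using assms by blast
  next
    fix S assume "S \<in> (\<lambda>x. {x}) ` topspace X"
    then obtain x where x: "x \<in> topspace X" "S = {x}"
      by blast
    have "X interior_of {x} \<noteq> {x}"
      using no[OF x(1)] by (metis openin_interior_of)
    then show "closedin X S \<and> X interior_of S = {}"
      using x t1 interior_of_subset[of X "{x}"] by (auto simp: closedin_t1_singleton)
  qed (use X in auto)
  then show False
    using assms by simp
qed

text \<open>Singletons are closed, so a countable set is F-sigma; its complement is then G-delta and
  inherits complete metrizability.\<close>

lemma completely_metrizable_space_diff_countable:
  assumes X: "completely_metrizable_space X" and "countable S"
  shows "completely_metrizable_space (subtopology X (topspace X - S))"
proof -
  have t1: "t1_space X"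
    using X by (simp add: completely_metrizable_imp_metrizable_space
        metrizable_imp_Hausdorff_space Hausdorff_imp_t1_space)
  have "fsigma_in X (\<Union>((\<lambda>x. {x}) ` (topspace X \<inter> S)))"
    using \<open>countable S\<close> t1
    by (intro fsigma_in_Union) (auto simp: closedin_t1_singleton closed_imp_fsigma_in)
  then have "fsigma_in X (topspace X \<inter> S)"
    by simp
  then have "gdelta_in X (topspace X - topspace X \<inter> S)"
    by (simp add: fsigma_in_gdelta_in)
  then show ?thesis
    using completely_metrizable_space_gdelta_in[OF X] by (simp add: Diff_Int_distrib2 Diff_Int)
qed

lemma completely_metrizable_cantor: "completely_metrizable_space (euclidean :: cantor topology)"
  by (simp add: euclidean_cantor completely_metrizable_space_product_topology
      completely_metrizable_space_discrete_topology)

lemma countable_cantor_Q: "countable cantor_Q"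
proof -
  have "inj_on supp cantor_Q"
    by (auto simp: inj_on_def supp_def)
  moreover have "countable (supp ` cantor_Q)"
    by (rule countable_subset[OF _ countable_Collect_finite]) (auto simp: cantor_Q_def)
  ultimately show ?thesis
    by (rule countable_image_inj_on[rotated])
qed

lemma uncountable_cantor: "uncountable (UNIV :: cantor set)"
proof
  assume "countable (UNIV :: cantor set)"
  then obtain f :: "nat \<Rightarrow> cantor" where "range f = UNIV"
    by (metis uncountable_def UNIV_not_empty)
  \<comment> \<open>Cantor's diagonal sequence: evaluating both sides at \<open>n\<close> gives the
    contradiction.\<close>
  then obtain n where "f n = (\<lambda>k. \<not> f k k)"
    by (metis UNIV_I image_iff)
  then show False
    by (metis (full_types))
qed

lemma uncountable_T_set: "uncountable T_set"
proof
  assume "countable T_set"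
  then have "countable (fst ` T_set)"
    by blast
  moreover have "fst ` T_set = UNIV"
  proof -
    \<comment> \<open>The diagonal lies in \<open>T_set\<close>, so the first projection is already
      onto the Cantor set.\<close>
    have "(x, x) \<in> T_set" for x
      by (auto simp: T_set_def cantor_P_def)
    then show ?thesis
      by (metis UNIV_eq_I fst_conv image_eqI)
  qed
  ultimately show False
    using uncountable_cantor by simp
qed

lemma completely_metrizable_P_times_P:
  "completely_metrizable_space (top_of_set (cantor_P \<times> cantor_P))"
proof -
  have "completely_metrizable_space (top_of_set cantor_P)"
    using completely_metrizable_space_diff_countable[OF completely_metrizable_cantor countable_cantor_Q]
    by (simp add: cantor_P_def)
  then show ?thesis
    by (metis completely_metrizable_space_prod_topology prod_topology_subtopology_eu)
qed

text \<open>Flipping the \<open>n\<close>-th coordinate of \<open>x\<close> changes the support by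
  one element, so it stays in \<open>cantor_Q\<close>; as \<open>n\<close> grows, these points
  differ from \<open>x\<close> but converge to it.\<close>

lemma cantor_Q_not_isolated:
  assumes "x \<in> cantor_Q"
  shows "\<not> openin (top_of_set cantor_Q) {x}"
proof
  assume "openin (top_of_set cantor_Q) {x}"
  then obtain U where U: "open U" "{x} = cantor_Q \<inter> U"
    by (auto simp: openin_open)
  define y where "y n = x(n := \<not> x n)" for n
  have "\<forall>\<^sub>F n in sequentially. y n i \<in> V" if "x i \<in> V" for i V
    \<comment> \<open>Coordinate \<open>i\<close> is altered only when \<open>n = i\<close>, so it
      is constant from \<open>Suc i\<close> on.\<close>
    by (rule eventually_sequentiallyI[of "Suc i"]) (use that in \<open>simp add: y_def\<close>)
  then have "limitin (product_topology (\<lambda>_. discrete_topology UNIV) UNIV) y x sequentially"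
    unfolding limitin_componentwise
    by (auto simp: limitin_def)
  then have "\<forall>\<^sub>F n in sequentially. y n \<in> U"
    using U by (auto simp flip: euclidean_cantor simp: limitin_def)
  then obtain n where "y n \<in> U"
    using eventually_happens' sequentially_bot by blast
  moreover have "supp (y n) \<subseteq> insert n (supp x)"
    by (auto simp: y_def supp_def split: if_splits)
  then have "y n \<in> cantor_Q"
    using assms finite_subset by (fastforce simp: cantor_Q_def)
  ultimately have "y n = x"
    using U by blast
  then have "y n n = x n"
    by simp
  then show False
    by (simp add: y_def)
qed

lemma zero_in_cantor_Q: "(\<lambda>_. False) \<in> cantor_Q"
  by (simp add: cantor_Q_def supp_def)

text \<open>An element \<open>g\<close> is bad only if \<open>a \<otimes> g = b\<close> for some
  \<open>a\<close> in \<open>A\<close> and \<open>b\<close> in \<open>B\<close>, that is,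
  \<open>g = inv a \<otimes> b\<close>; there are only countably many such elements.\<close>

lemma (in group) countable_sets_translate_disjoint:
  assumes "countable A" "countable B" "A \<subseteq> carrier G" "B \<subseteq> carrier G" "uncountable (carrier G)"
  obtains g where "g \<in> carrier G" "\<And>a. a \<in> A \<Longrightarrow> a \<otimes> g \<notin> B"
proof -
  have "countable ((\<lambda>(a, b). inv a \<otimes> b) ` (A \<times> B))"
    using assms by blast
  then obtain g where g: "g \<in> carrier G" "g \<notin> (\<lambda>(a, b). inv a \<otimes> b) ` (A \<times> B)"
    using assms(5) by (meson countable_subset subsetI)
  have "a \<otimes> g \<notin> B" if "a \<in> A" for a
  proof
    assume "a \<otimes> g \<in> B"
    moreover have "g = inv a \<otimes> (a \<otimes> g)"
      using that assms g by (simp add: inv_solve_left subset_iff)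
    ultimately show False
      using g that by force
  qed
  with g show thesis
    using that by blast
qed

text \<open>The inverse map is right translation by \<open>inv g\<close>, which is continuous by the
  same hypothesis.\<close>

lemma right_translation_homeomorphic_map:
  fixes G (structure)
  assumes "right_topological_group G X" and g: "g \<in> carrier G"
  shows "homeomorphic_map X X (\<lambda>x. x \<otimes>\<^bsub>G\<^esub> g)"
proof -
  interpret group G
    using assms by (simp add: right_topological_group_def)
  have "homeomorphic_maps X X (\<lambda>x. x \<otimes> g) (\<lambda>x. x \<otimes> inv g)"
    using assms unfolding homeomorphic_maps_def right_topological_group_def
    by (auto simp: m_assoc)
  then show ?thesis
    by (rule homeomorphic_maps_imp_map)
qed

theorem proposition9:
  "\<not> (\<exists>G :: (cantor \<times> cantor) monoid. right_topological_group G (top_of_set T_set))"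
proof
  assume "\<exists>G :: (cantor \<times> cantor) monoid. right_topological_group G (top_of_set T_set)"
  then obtain G :: "(cantor \<times> cantor) monoid"
    where G: "right_topological_group G (top_of_set T_set)" ..
  then interpret group G
    by (simp add: right_topological_group_def)
  have carrier: "carrier G = T_set"
    using G by (auto simp: right_topological_group_def)
  define z :: cantor where "z = (\<lambda>_. False)"
  define A where "A = {z} \<times> cantor_Q"
  have zQ: "z \<in> cantor_Q"
    by (simp add: z_def zero_in_cantor_Q)
  have A_sub: "A \<subseteq> T_set"
    using zQ by (auto simp: A_def T_set_def)
  have "t1_space (euclidean :: cantor topology)"
    by (simp add: completely_metrizable_cantor completely_metrizable_imp_metrizable_space
        metrizable_imp_Hausdorff_space Hausdorff_imp_t1_space)
  then have "closed {z}"
    using closedin_t1_singleton[of euclidean z] by (simp only: closed_closedin topspace_euclidean UNIV_I)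
  then have "closed ({z} \<times> (UNIV :: cantor set))"
    by (simp add: closed_Times)
  \<comment> \<open>Since \<open>z\<close> is in \<open>cantor_Q\<close>, the vertical line over
    \<open>z\<close> misses \<open>cantor_P \<times> cantor_P\<close>.\<close>
  moreover have "A = T_set \<inter> ({z} \<times> UNIV)"
    using zQ by (auto simp: A_def T_set_def cantor_P_def)
  ultimately have A_closed: "closedin (top_of_set T_set) A"
    by (auto simp: closedin_closed)
  obtain g where g: "g \<in> carrier G" "\<And>a. a \<in> A \<Longrightarrow> a \<otimes>\<^bsub>G\<^esub> g \<notin> cantor_Q \<times> cantor_Q"
    by (rule countable_sets_translate_disjoint[of A "cantor_Q \<times> cantor_Q"])
      (use A_sub uncountable_T_set countable_cantor_Q in \<open>auto simp: carrier A_def T_set_def\<close>)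
  define r where "r x = x \<otimes>\<^bsub>G\<^esub> g" for x
  have hom: "homeomorphic_map (top_of_set T_set) (top_of_set T_set) r"
    unfolding r_def by (rule right_translation_homeomorphic_map[OF G g(1)])
  have rA_closed: "closedin (top_of_set T_set) (r ` A)"
    using homeomorphic_map_closedness[OF hom] A_sub A_closed by simp
  have "r ` A \<subseteq> T_set"
    using rA_closed closedin_subset by fastforce
  then have rA: "r ` A \<subseteq> cantor_P \<times> cantor_P"
    using g(2) unfolding r_def T_set_def by blast
  \<comment> \<open>Closedness in \<open>T_set\<close> passes to the smaller subspace, where
    complete metrizability is available.\<close>
  have "closedin (top_of_set (cantor_P \<times> cantor_P)) (r ` A)"
    using rA_closed rA by (rule closedin_subset_trans) (auto simp: T_set_def)
  then have "completely_metrizable_space (subtopology (top_of_set (cantor_P \<times> cantor_P)) (r ` A))"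
    by (rule completely_metrizable_space_closedin[OF completely_metrizable_P_times_P])
  then have "completely_metrizable_space (top_of_set (r ` A))"
    using rA by (simp add: subtopology_subtopology Int_absorb1)
  moreover have "countable (r ` A)" "r ` A \<noteq> {}"
    using countable_cantor_Q zQ by (auto simp: A_def)
  ultimately obtain k where k: "k \<in> r ` A" "openin (top_of_set (r ` A)) {k}"
    by (metis countable_completely_metrizable_isolated_point topspace_euclidean_subtopology)
  then obtain q where q: "q \<in> cantor_Q" "k = r (z, q)"
    by (auto simp: A_def)
  have inj: "inj_on r T_set"
    using homeomorphic_imp_injective_map[OF hom] by simp
  have "continuous_on T_set r"
    using homeomorphic_imp_continuous_map[OF hom] by simp
  \<comment> \<open>Pulling the isolated point \<open>k\<close> back along this injective continuous
    map makes \<open>q\<close> isolated in \<open>cantor_Q\<close>.\<close>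
  then have "continuous_on cantor_Q (\<lambda>y. r (z, y))"
    by (rule continuous_on_compose2) (use A_sub in \<open>auto simp: A_def intro!: continuous_intros\<close>)
  then have "openin (top_of_set cantor_Q) (cantor_Q \<inter> (\<lambda>y. r (z, y)) -` {k})"
    by (rule continuous_openin_preimage[OF _ _ k(2)]) (auto simp: A_def)
  moreover have "cantor_Q \<inter> (\<lambda>y. r (z, y)) -` {k} = {q}"
  proof -
    have "x = q" if "x \<in> cantor_Q" "r (z, x) = r (z, q)" for x
      using inj_onD[OF inj that(2)] A_sub q(1) that(1) by (auto simp: A_def)
    then show ?thesis
      using q by blast
  qed
  ultimately show False
    using cantor_Q_not_isolated[OF q(1)] by simp
qed

end
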